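(* Let $d\ge 2$, let $\Omega\subset\mathbb{R}^d$ be a bounded domain with Lipschitz boundary such that $\mathbb{R}^d\setminus\overline{\Omega}$ is connected, and let $a>0$ be a constant with $a\neq 1$. Suppose $A=a\,\mathrm{Id}$ and $q=a$ in $\Omega$. Then $\mathscr{S}_{\mathrm{TE}}=\mathscr{S}_{\mathrm{D}}\cup\mathscr{S}_{\mathrm{N}}$.
   Context: $\mathscr{S}_{\mathrm{TE}}$ (transmission eigenvalues) is the set of $k>0$ for which there is a non-zero pair $(u,v)\in \mathrm{H}^1(\Omega)\times \mathrm{H}^1(\Omega)$ with $\mathrm{div}(A\nabla u)+k^2qu=0$ and $\Delta v+k^2v=0$ in $\Omega$, and $u=v$, $\nu\cdot A\nabla u=\nu\cdot\nabla v$ on $\partial\Omega$ (weak sense), where $\nu$ is the unit outward normal to $\partial\Omega$. $\mathscr{S}_{\mathrm{D}}$ (resp. $\mathscr{S}_{\mathrm{N}}$) is the set of $k>0$ for which there is a non-zero $w\in \mathrm{H}^1(\Omega)$ with $\Delta w+k^2w=0$ in $\Omega$ and $w=0$ (resp. $\partial_\nu w=0$) on $\partial\Omega$. *)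

theory Defs
  imports "HOL-Analysis.Analysis"
begin

subsection \<open>Lipschitz boundary\<close>

text \<open>Near each boundary point, and in suitable orthonormal coordinates with last axis \<open>e\<close>, the set
  is the strict epigraph of a Lipschitz function \<open>\<gamma>\<close> of the remaining coordinates. Here \<open>\<gamma>\<close> is only
  evaluated on the hyperplane orthogonal to \<open>e\<close>.\<close>
definition lipschitz_boundary :: "(real ^ 'n) set \<Rightarrow> bool" where
  "lipschitz_boundary \<Omega> \<longleftrightarrow>
     (\<forall>p \<in> frontier \<Omega>. \<exists>r > 0. \<exists>e \<gamma> L. norm e = 1 \<and> L-lipschitz_on UNIV \<gamma> \<and>
        \<Omega> \<inter> ball p r = {y \<in> ball p r. \<gamma> (y - (y \<bullet> e) *\<^sub>R e) < y \<bullet> e})"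

subsection \<open>Test functions\<close>

definition partial_deriv :: "'n \<Rightarrow> (real ^ 'n \<Rightarrow> complex) \<Rightarrow> real ^ 'n \<Rightarrow> complex" where
  "partial_deriv i \<phi> x = frechet_derivative \<phi> (at x) (axis i 1)"

definition grad :: "(real ^ 'n \<Rightarrow> complex) \<Rightarrow> real ^ 'n \<Rightarrow> complex ^ 'n" where
  "grad \<phi> x = (\<chi> i. partial_deriv i \<phi> x)"

primrec C_k :: "nat \<Rightarrow> (real ^ 'n \<Rightarrow> complex) \<Rightarrow> bool" where
  "C_k 0 \<phi> \<longleftrightarrow> continuous_on UNIV \<phi>"
| "C_k (Suc k) \<phi> \<longleftrightarrow> (\<forall>x. \<phi> differentiable (at x)) \<and> (\<forall>i. C_k k (partial_deriv i \<phi>))"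

definition test_functions :: "(real ^ 'n) set \<Rightarrow> (real ^ 'n \<Rightarrow> complex) set" where
  "test_functions \<Omega> =
     {\<phi>. (\<forall>k. C_k k \<phi>) \<and> compact (closure {x. \<phi> x \<noteq> 0}) \<and> closure {x. \<phi> x \<noteq> 0} \<subseteq> \<Omega>}"

subsection \<open>Weak derivatives and Sobolev spaces\<close>

text \<open>Elements of \<open>L\<^sup>2(\<Omega>)\<close> and \<open>H\<^sup>1(\<Omega>)\<close> are represented by functions on the whole space whose values
  outside \<open>\<Omega>\<close> are irrelevant, and equality is equality almost everywhere on \<open>\<Omega>\<close>. The weak gradient
  and weak divergence are accordingly relations, being determined only up to null sets.\<close>

definition L2 :: "(real ^ 'n) set \<Rightarrow> (real ^ 'n \<Rightarrow> 'b::euclidean_space) set" where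
  "L2 \<Omega> = {f \<in> borel_measurable (lebesgue_on \<Omega>). integrable (lebesgue_on \<Omega>) (\<lambda>x. (norm (f x))\<^sup>2)}"

text \<open>Bilinear, i.e. without complex conjugation.\<close>
definition cdot :: "complex ^ 'n \<Rightarrow> complex ^ 'n \<Rightarrow> complex" (infixl "\<cdot>\<^sub>c" 70) where
  "F \<cdot>\<^sub>c G = (\<Sum>i\<in>UNIV. F $ i * G $ i)"

definition has_weak_grad ::
    "(real ^ 'n) set \<Rightarrow> (real ^ 'n \<Rightarrow> complex) \<Rightarrow> (real ^ 'n \<Rightarrow> complex ^ 'n) \<Rightarrow> bool" where
  "has_weak_grad \<Omega> u g \<longleftrightarrow> u \<in> L2 \<Omega> \<and> g \<in> L2 \<Omega> \<and>
     (\<forall>\<phi> \<in> test_functions \<Omega>. \<forall>i.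
        (\<integral>x. u x * partial_deriv i \<phi> x \<partial>lebesgue_on \<Omega>) = - (\<integral>x. g x $ i * \<phi> x \<partial>lebesgue_on \<Omega>))"

definition has_weak_div ::
    "(real ^ 'n) set \<Rightarrow> (real ^ 'n \<Rightarrow> complex ^ 'n) \<Rightarrow> (real ^ 'n \<Rightarrow> complex) \<Rightarrow> bool" where
  "has_weak_div \<Omega> F f \<longleftrightarrow> F \<in> L2 \<Omega> \<and> f \<in> L2 \<Omega> \<and>
     (\<forall>\<phi> \<in> test_functions \<Omega>.
        (\<integral>x. F x \<cdot>\<^sub>c grad \<phi> x \<partial>lebesgue_on \<Omega>) = - (\<integral>x. f x * \<phi> x \<partial>lebesgue_on \<Omega>))"

definition H1 :: "(real ^ 'n) set \<Rightarrow> (real ^ 'n \<Rightarrow> complex) set" where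
  "H1 \<Omega> = {u. \<exists>g. has_weak_grad \<Omega> u g}"

text \<open>The closure of the test functions in \<open>H\<^sup>1(\<Omega>)\<close>.\<close>
definition H1_0 :: "(real ^ 'n) set \<Rightarrow> (real ^ 'n \<Rightarrow> complex) set" where
  "H1_0 \<Omega> = {u. \<exists>g. has_weak_grad \<Omega> u g \<and>
     (\<exists>\<phi> :: nat \<Rightarrow> real ^ 'n \<Rightarrow> complex. (\<forall>m. \<phi> m \<in> test_functions \<Omega>) \<and>
        (\<lambda>m. (\<integral>x. (norm (\<phi> m x - u x))\<^sup>2 \<partial>lebesgue_on \<Omega>)
            + (\<integral>x. (norm (grad (\<phi> m) x - g x))\<^sup>2 \<partial>lebesgue_on \<Omega>)) \<longlonglongrightarrow> 0)}"

subsection \<open>Boundary conditions in the weak sense\<close>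

definition eq_on_boundary ::
    "(real ^ 'n) set \<Rightarrow> (real ^ 'n \<Rightarrow> complex) \<Rightarrow> (real ^ 'n \<Rightarrow> complex) \<Rightarrow> bool" where
  "eq_on_boundary \<Omega> u v \<longleftrightarrow> (\<lambda>x. u x - v x) \<in> H1_0 \<Omega>"

text \<open>For \<open>F \<in> L\<^sup>2(\<Omega>)\<^sup>d\<close> with weak divergence \<open>f \<in> L\<^sup>2(\<Omega>)\<close>, the normal trace \<open>\<nu> \<cdot> F\<close> is the
  functional \<open>\<phi> \<mapsto> \<integral>\<^sub>\<Omega> F \<cdot> \<nabla>\<phi> + f \<phi>\<close> on \<open>H\<^sup>1(\<Omega>)\<close> given by Green's formula. The function \<open>f\<close> is
  passed explicitly, as is the weak gradient \<open>h\<close> of \<open>\<phi>\<close>.\<close>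
definition normal_trace ::
    "(real ^ 'n) set \<Rightarrow> (real ^ 'n \<Rightarrow> complex ^ 'n) \<Rightarrow> (real ^ 'n \<Rightarrow> complex) \<Rightarrow>
     (real ^ 'n \<Rightarrow> complex) \<Rightarrow> (real ^ 'n \<Rightarrow> complex ^ 'n) \<Rightarrow> complex" where
  "normal_trace \<Omega> F f \<phi> h = (\<integral>x. F x \<cdot>\<^sub>c h x + f x * \<phi> x \<partial>lebesgue_on \<Omega>)"

subsection \<open>Eigenvalues\<close>

definition zero_on :: "(real ^ 'n) set \<Rightarrow> (real ^ 'n \<Rightarrow> complex) \<Rightarrow> bool" where
  "zero_on \<Omega> u \<longleftrightarrow> (AE x in lebesgue_on \<Omega>. u x = 0)"

text \<open>A real matrix applied to a complex vector.\<close>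
definition mat_app :: "real ^ 'n ^ 'n \<Rightarrow> complex ^ 'n \<Rightarrow> complex ^ 'n" where
  "mat_app M z = (\<chi> i j. complex_of_real (M $ i $ j)) *v z"

text \<open>The equation \<open>div (A \<nabla>u) + k\<^sup>2 q u = 0\<close> is expressed by saying that \<open>-k\<^sup>2 q u\<close> is the weak
  divergence of \<open>A \<nabla>u\<close>, and similarly for the other Helmholtz equations.\<close>

definition transmission_eigenvalues ::
    "(real ^ 'n) set \<Rightarrow> (real ^ 'n \<Rightarrow> real ^ 'n ^ 'n) \<Rightarrow> (real ^ 'n \<Rightarrow> real) \<Rightarrow> real set" where
  "transmission_eigenvalues \<Omega> A q = {k. 0 < k \<and>
     (\<exists>u \<in> H1 \<Omega>. \<exists>v \<in> H1 \<Omega>. \<exists>gu gv. has_weak_grad \<Omega> u gu \<and> has_weak_grad \<Omega> v gv \<and>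
        \<not> (zero_on \<Omega> u \<and> zero_on \<Omega> v) \<and>
        has_weak_div \<Omega> (\<lambda>x. mat_app (A x) (gu x)) (\<lambda>x. - of_real (k\<^sup>2 * q x) * u x) \<and>
        has_weak_div \<Omega> gv (\<lambda>x. - of_real (k\<^sup>2) * v x) \<and>
        eq_on_boundary \<Omega> u v \<and>
        (\<forall>\<phi> h. has_weak_grad \<Omega> \<phi> h \<longrightarrow>
           normal_trace \<Omega> (\<lambda>x. mat_app (A x) (gu x)) (\<lambda>x. - of_real (k\<^sup>2 * q x) * u x) \<phi> h
           = normal_trace \<Omega> gv (\<lambda>x. - of_real (k\<^sup>2) * v x) \<phi> h))}"

definition dirichlet_eigenvalues :: "(real ^ 'n) set \<Rightarrow> real set" where
  "dirichlet_eigenvalues \<Omega> = {k. 0 < k \<and>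
     (\<exists>w \<in> H1 \<Omega>. \<exists>g. has_weak_grad \<Omega> w g \<and> \<not> zero_on \<Omega> w \<and>
        has_weak_div \<Omega> g (\<lambda>x. - of_real (k\<^sup>2) * w x) \<and>
        eq_on_boundary \<Omega> w (\<lambda>x. 0))}"

definition neumann_eigenvalues :: "(real ^ 'n) set \<Rightarrow> real set" where
  "neumann_eigenvalues \<Omega> = {k. 0 < k \<and>
     (\<exists>w \<in> H1 \<Omega>. \<exists>g. has_weak_grad \<Omega> w g \<and> \<not> zero_on \<Omega> w \<and>
        has_weak_div \<Omega> g (\<lambda>x. - of_real (k\<^sup>2) * w x) \<and>
        (\<forall>\<phi> h. has_weak_grad \<Omega> \<phi> h \<longrightarrow>
           normal_trace \<Omega> g (\<lambda>x. - of_real (k\<^sup>2) * w x) \<phi> h = 0))}"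

end

theory Submission
  imports Defs
begin

text \<open>If \<open>(u, v)\<close> is a transmission eigenpair, then \<open>u - v\<close> has vanishing trace and \<open>a u - v\<close> has
  vanishing normal trace, both solve the Helmholtz equation, and they cannot both vanish since
  \<open>a \<noteq> 1\<close>. Conversely, a Neumann eigenfunction \<open>w\<close> gives the pair \<open>(w, w)\<close>, and a Dirichlet
  eigenfunction \<open>w\<close> gives the pair \<open>(w, a w) / (1 - a)\<close>, whose difference is \<open>w\<close>. Working with
  \<open>a u - v\<close> and its gradient \<open>a \<nabla>u - \<nabla>v\<close>, rather than with \<open>u\<close> when \<open>u = v\<close>, avoids the almost
  everywhere uniqueness of weak gradients.\<close>

section \<open>Square-integrable functions and integrable products\<close>

lemma L2_cong:
  assumes "\<And>x. x \<in> \<Omega> \<Longrightarrow> f x = f' x"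
  shows "f \<in> L2 \<Omega> \<longleftrightarrow> f' \<in> L2 \<Omega>"
proof -
  have "f \<in> borel_measurable (lebesgue_on \<Omega>) \<longleftrightarrow> f' \<in> borel_measurable (lebesgue_on \<Omega>)"
    by (rule measurable_cong) (simp add: assms)
  moreover have "integrable (lebesgue_on \<Omega>) (\<lambda>x. (norm (f x))\<^sup>2) \<longleftrightarrow>
      integrable (lebesgue_on \<Omega>) (\<lambda>x. (norm (f' x))\<^sup>2)"
    by (rule Bochner_Integration.integrable_cong) (simp_all add: assms)
  ultimately show ?thesis
    by (simp add: L2_def)
qed

lemma L2_zero: "(\<lambda>x. 0) \<in> L2 \<Omega>"
  by (simp add: L2_def)

text \<open>The elementary bound \<open>(s + t)\<^sup>2 \<le> 2 * s\<^sup>2 + 2 * t\<^sup>2\<close>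
  supplies an integrable majorant.\<close>

lemma L2_lincomb:
  fixes f g :: "real ^ 'n \<Rightarrow> 'b::euclidean_space"
  assumes f: "f \<in> L2 \<Omega>" and g: "g \<in> L2 \<Omega>"
  shows "(\<lambda>x. c *\<^sub>R f x + d *\<^sub>R g x) \<in> L2 \<Omega>"
proof -
  have [measurable]: "f \<in> borel_measurable (lebesgue_on \<Omega>)" "g \<in> borel_measurable (lebesgue_on \<Omega>)"
    using f g by (auto simp: L2_def)
  have bound: "(norm (c *\<^sub>R f x + d *\<^sub>R g x))\<^sup>2
      \<le> 2 * c\<^sup>2 * (norm (f x))\<^sup>2 + 2 * d\<^sup>2 * (norm (g x))\<^sup>2" for x
  proof -
    have "(norm (c *\<^sub>R f x + d *\<^sub>R g x))\<^sup>2 \<le> (\<bar>c\<bar> * norm (f x) + \<bar>d\<bar> * norm (g x))\<^sup>2"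
      by (rule power_mono) (use norm_triangle_ineq[of "c *\<^sub>R f x" "d *\<^sub>R g x"] in auto)
    \<comment> \<open>The cross term of the expanded square is absorbed by
      \<open>2 * s * t \<le> s\<^sup>2 + t\<^sup>2\<close>.\<close>
    also have "\<dots> \<le> 2 * (\<bar>c\<bar> * norm (f x))\<^sup>2 + 2 * (\<bar>d\<bar> * norm (g x))\<^sup>2"
      using sum_squares_bound[of "\<bar>c\<bar> * norm (f x)" "\<bar>d\<bar> * norm (g x)"]
      by (simp add: power2_sum)
    finally show ?thesis
      by (simp add: power_mult_distrib)
  qed
  show ?thesis
    unfolding L2_def
  proof (intro CollectI conjI)
    show "integrable (lebesgue_on \<Omega>) (\<lambda>x. (norm (c *\<^sub>R f x + d *\<^sub>R g x))\<^sup>2)"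
    proof (rule Bochner_Integration.integrable_bound)
      show "integrable (lebesgue_on \<Omega>)
          (\<lambda>x. 2 * c\<^sup>2 * (norm (f x))\<^sup>2 + 2 * d\<^sup>2 * (norm (g x))\<^sup>2)"
        using f g by (auto simp: L2_def)
    qed (use bound in simp_all)
  qed simp
qed

lemma L2_component:
  fixes F :: "real ^ 'n \<Rightarrow> complex ^ 'm"
  assumes F: "F \<in> L2 \<Omega>"
  shows "(\<lambda>x. F x $ i) \<in> L2 \<Omega>"
proof -
  have [measurable]: "F \<in> borel_measurable (lebesgue_on \<Omega>)"
    using F by (simp add: L2_def)
  have [measurable]: "(\<lambda>y :: complex ^ 'm. y $ i) \<in> borel_measurable borel"
    by (intro borel_measurable_continuous_onI continuous_intros)
  have meas: "(\<lambda>x. F x $ i) \<in> borel_measurable (lebesgue_on \<Omega>)"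
    by measurable
  have "(norm (F x $ i))\<^sup>2 \<le> (norm (F x))\<^sup>2" for x
    by (intro power_mono Finite_Cartesian_Product.norm_nth_le norm_ge_zero)
  then have "integrable (lebesgue_on \<Omega>) (\<lambda>x. (norm (F x $ i))\<^sup>2)"
    using F meas unfolding L2_def
    by - (rule Bochner_Integration.integrable_bound[of _ "\<lambda>x. (norm (F x))\<^sup>2"], simp_all)
  with meas show ?thesis
    by (simp add: L2_def)
qed

text \<open>A crude form of the Hoelder inequality:
  \<open>2 * s * t \<le> s\<^sup>2 + t\<^sup>2\<close> bounds the product, the factor 2 being
  dropped since \<open>s * t\<close> is nonnegative. Every splitting of an integral below rests on
  this.\<close>

lemma integrable_mult_L2:
  fixes f g :: "real ^ 'n \<Rightarrow> complex"
  assumes f: "f \<in> L2 \<Omega>" and g: "g \<in> L2 \<Omega>"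
  shows "integrable (lebesgue_on \<Omega>) (\<lambda>x. f x * g x)"
proof (rule Bochner_Integration.integrable_bound)
  show "integrable (lebesgue_on \<Omega>) (\<lambda>x. (norm (f x))\<^sup>2 + (norm (g x))\<^sup>2)"
    using f g by (auto simp: L2_def)
  show "(\<lambda>x. f x * g x) \<in> borel_measurable (lebesgue_on \<Omega>)"
    using f g by (auto simp: L2_def)
  have "norm (f x * g x) \<le> (norm (f x))\<^sup>2 + (norm (g x))\<^sup>2" for x
  proof -
    have "2 * (norm (f x) * norm (g x)) \<le> (norm (f x))\<^sup>2 + (norm (g x))\<^sup>2"
      using sum_squares_bound[of "norm (f x)" "norm (g x)"] by (simp add: mult.assoc)
    moreover have "0 \<le> norm (f x) * norm (g x)"
      by simp
    ultimately show ?thesis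
      by (simp only: norm_mult)
  qed
  then show "AE x in lebesgue_on \<Omega>. norm (f x * g x) \<le> norm ((norm (f x))\<^sup>2 + (norm (g x))\<^sup>2)"
    by simp
qed

text \<open>The second factor enters componentwise because that is how the gradient of a test
  function is controlled: each component of \<open>grad \<phi>\<close> is a single
  \<open>partial_deriv\<close>.\<close>

lemma integrable_cdot:
  assumes "F \<in> L2 \<Omega>" and "\<And>i. (\<lambda>x. G x $ i) \<in> L2 \<Omega>"
  shows "integrable (lebesgue_on \<Omega>) (\<lambda>x. F x \<cdot>\<^sub>c G x)"
  unfolding cdot_def
  by (intro Bochner_Integration.integrable_sum integrable_mult_L2 L2_component assms)

lemma cdot_lincomb: "(c *\<^sub>R F + d *\<^sub>R G) \<cdot>\<^sub>c H = c *\<^sub>R (F \<cdot>\<^sub>c H) + d *\<^sub>R (G \<cdot>\<^sub>c H)"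
  by (simp add: cdot_def sum.distrib scaleR_sum_right distrib_right)

section \<open>Test functions and the zero element of \<open>H1_0\<close>\<close>

lemma continuous_imp_L2:
  fixes f :: "real ^ 'n \<Rightarrow> 'b::euclidean_space"
  assumes "continuous_on UNIV f" "open \<Omega>" "bounded \<Omega>"
  shows "f \<in> L2 \<Omega>"
proof -
  have meas: "f \<in> borel_measurable (lebesgue_on \<Omega>)"
    using assms by (intro continuous_imp_measurable_on_sets_lebesgue)
      (auto intro: continuous_on_subset)
  interpret finite_measure "lebesgue_on \<Omega>"
    using assms by (intro finite_measure_lebesgue_on lmeasurable_open)
  \<comment> \<open>Boundedness of \<open>\<Omega>\<close> makes its closure compact, so
    \<open>f\<close> is bounded there; on a space of finite measure a bounded measurable function is
    square integrable.\<close>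
  have "compact (f ` closure \<Omega>)"
    using assms by (intro compact_continuous_image) (auto intro: continuous_on_subset)
  then obtain B where B: "\<And>x. x \<in> closure \<Omega> \<Longrightarrow> norm (f x) \<le> B"
    by (meson compact_imp_bounded bounded_iff imageI)
  have "AE x in lebesgue_on \<Omega>. norm ((norm (f x))\<^sup>2) \<le> B\<^sup>2"
    by (rule AE_I2) (use B closure_subset in \<open>auto intro!: power_mono\<close>)
  then have "integrable (lebesgue_on \<Omega>) (\<lambda>x. (norm (f x))\<^sup>2)"
    by (rule integrable_const_bound) (use meas in measurable)
  with meas show ?thesis
    by (simp add: L2_def)
qed

lemma test_function_L2:
  assumes "\<phi> \<in> test_functions \<Omega>" "open \<Omega>" "bounded \<Omega>"
  shows "\<phi> \<in> L2 \<Omega>"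
proof -
  have "C_k 0 \<phi>"
    using assms unfolding test_functions_def by blast
  with assms show ?thesis
    by (auto intro: continuous_imp_L2)
qed

lemma partial_deriv_test_function_L2:
  assumes "\<phi> \<in> test_functions \<Omega>" "open \<Omega>" "bounded \<Omega>"
  shows "partial_deriv i \<phi> \<in> L2 \<Omega>"
proof -
  \<comment> \<open>One level of \<open>C_k\<close> unfolds to continuity of each partial
    derivative.\<close>
  have "C_k (Suc 0) \<phi>"
    using assms unfolding test_functions_def by blast
  with assms show ?thesis
    by (auto intro: continuous_imp_L2)
qed

lemma zero_test_function:
  fixes \<Omega> :: "(real ^ 'n) set"
  shows "(\<lambda>x. 0) \<in> test_functions \<Omega>"
proof -
  have "partial_deriv i (\<lambda>x :: real ^ 'n. 0) = (\<lambda>x. 0)" for i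
    by (simp add: partial_deriv_def fun_eq_iff)
  then have "C_k k (\<lambda>x :: real ^ 'n. 0)" for k
    by (induction k) auto
  then show ?thesis
    by (simp add: test_functions_def)
qed

text \<open>Provides the boundary condition for a pair \<open>(w, w)\<close>, whose difference is
  zero; the approximating sequence is constantly zero.\<close>

lemma zero_H1_0:
  fixes \<Omega> :: "(real ^ 'n) set"
  shows "(\<lambda>x. 0) \<in> H1_0 \<Omega>"
proof -
  have "has_weak_grad \<Omega> (\<lambda>x. 0) (\<lambda>x. 0)"
    by (simp add: has_weak_grad_def L2_zero)
  moreover have "grad (\<lambda>x :: real ^ 'n. 0) = (\<lambda>x. 0)"
    by (simp add: grad_def partial_deriv_def fun_eq_iff vec_eq_iff)
  ultimately show ?thesis
    unfolding H1_0_def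
    by (intro CollectI exI[of _ "\<lambda>x. 0"] exI[of _ "\<lambda>m x. 0"] conjI) (auto simp: zero_test_function)
qed

section \<open>Linearity of weak gradients, weak divergences and normal traces\<close>

lemma has_weak_grad_lincomb:
  assumes \<Omega>: "open \<Omega>" "bounded \<Omega>"
    and u: "has_weak_grad \<Omega> u gu" and v: "has_weak_grad \<Omega> v gv"
  shows "has_weak_grad \<Omega> (\<lambda>x. c *\<^sub>R u x + d *\<^sub>R v x) (\<lambda>x. c *\<^sub>R gu x + d *\<^sub>R gv x)"
  unfolding has_weak_grad_def
proof (intro conjI ballI allI)
  have L2: "u \<in> L2 \<Omega>" "v \<in> L2 \<Omega>" "gu \<in> L2 \<Omega>" "gv \<in> L2 \<Omega>"
    using u v by (auto simp: has_weak_grad_def)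
  then show "(\<lambda>x. c *\<^sub>R u x + d *\<^sub>R v x) \<in> L2 \<Omega>" "(\<lambda>x. c *\<^sub>R gu x + d *\<^sub>R gv x) \<in> L2 \<Omega>"
    by (auto intro: L2_lincomb)
  fix \<phi> i
  assume \<phi>: "\<phi> \<in> test_functions \<Omega>"
  \<comment> \<open>The integral of a sum splits once both summands are integrable. Each summand
    here is a product of two \<open>L2\<close> functions, the test function and its derivatives
    included.\<close>
  note [simp] = integrable_mult_L2 L2 L2_component
    test_function_L2[OF \<phi> \<Omega>] partial_deriv_test_function_L2[OF \<phi> \<Omega>]
  have eqs: "(\<integral>x. u x * partial_deriv i \<phi> x \<partial>lebesgue_on \<Omega>) = - (\<integral>x. gu x $ i * \<phi> x \<partial>lebesgue_on \<Omega>)"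
    "(\<integral>x. v x * partial_deriv i \<phi> x \<partial>lebesgue_on \<Omega>) = - (\<integral>x. gv x $ i * \<phi> x \<partial>lebesgue_on \<Omega>)"
    using u v \<phi> by (auto simp: has_weak_grad_def)
  show "(\<integral>x. (c *\<^sub>R u x + d *\<^sub>R v x) * partial_deriv i \<phi> x \<partial>lebesgue_on \<Omega>)
      = - (\<integral>x. (c *\<^sub>R gu x + d *\<^sub>R gv x) $ i * \<phi> x \<partial>lebesgue_on \<Omega>)"
    by (simp add: distrib_right eqs)
qed

lemma has_weak_div_lincomb:
  assumes \<Omega>: "open \<Omega>" "bounded \<Omega>"
    and F: "has_weak_div \<Omega> F f" and G: "has_weak_div \<Omega> G g"
  shows "has_weak_div \<Omega> (\<lambda>x. c *\<^sub>R F x + d *\<^sub>R G x) (\<lambda>x. c *\<^sub>R f x + d *\<^sub>R g x)"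
  unfolding has_weak_div_def
proof (intro conjI ballI)
  have L2: "F \<in> L2 \<Omega>" "f \<in> L2 \<Omega>" "G \<in> L2 \<Omega>" "g \<in> L2 \<Omega>"
    using F G by (auto simp: has_weak_div_def)
  then show "(\<lambda>x. c *\<^sub>R F x + d *\<^sub>R G x) \<in> L2 \<Omega>" "(\<lambda>x. c *\<^sub>R f x + d *\<^sub>R g x) \<in> L2 \<Omega>"
    by (auto intro: L2_lincomb)
  fix \<phi>
  assume \<phi>: "\<phi> \<in> test_functions \<Omega>"
  have "(\<lambda>x. grad \<phi> x $ i) \<in> L2 \<Omega>" for i
    using partial_deriv_test_function_L2[OF \<phi> \<Omega>] by (simp add: grad_def)
  note [simp] = integrable_mult_L2 integrable_cdot L2 this test_function_L2[OF \<phi> \<Omega>]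
  have eqs: "(\<integral>x. F x \<cdot>\<^sub>c grad \<phi> x \<partial>lebesgue_on \<Omega>) = - (\<integral>x. f x * \<phi> x \<partial>lebesgue_on \<Omega>)"
    "(\<integral>x. G x \<cdot>\<^sub>c grad \<phi> x \<partial>lebesgue_on \<Omega>) = - (\<integral>x. g x * \<phi> x \<partial>lebesgue_on \<Omega>)"
    using F G \<phi> by (auto simp: has_weak_div_def)
  show "(\<integral>x. (c *\<^sub>R F x + d *\<^sub>R G x) \<cdot>\<^sub>c grad \<phi> x \<partial>lebesgue_on \<Omega>)
      = - (\<integral>x. (c *\<^sub>R f x + d *\<^sub>R g x) * \<phi> x \<partial>lebesgue_on \<Omega>)"
    by (simp add: distrib_right cdot_lincomb eqs)
qed

text \<open>Integrals over \<open>lebesgue_on \<Omega>\<close> ignore values outside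
  \<open>\<Omega>\<close>. As \<open>A\<close> and \<open>q\<close> are prescribed only on
  \<open>\<Omega>\<close>, this is what allows the constant \<open>a\<close> to replace them in the
  weak equation.\<close>

lemma has_weak_div_cong:
  assumes "\<And>x. x \<in> \<Omega> \<Longrightarrow> F x = F' x" "\<And>x. x \<in> \<Omega> \<Longrightarrow> f x = f' x"
  shows "has_weak_div \<Omega> F f \<longleftrightarrow> has_weak_div \<Omega> F' f'"
proof -
  have "(\<integral>x. F x \<cdot>\<^sub>c grad \<phi> x \<partial>lebesgue_on \<Omega>) = (\<integral>x. F' x \<cdot>\<^sub>c grad \<phi> x \<partial>lebesgue_on \<Omega>)"
    "(\<integral>x. f x * \<phi> x \<partial>lebesgue_on \<Omega>) = (\<integral>x. f' x * \<phi> x \<partial>lebesgue_on \<Omega>)" for \<phi>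
    by (auto intro!: Bochner_Integration.integral_cong simp: assms)
  moreover have "F \<in> L2 \<Omega> \<longleftrightarrow> F' \<in> L2 \<Omega>" "f \<in> L2 \<Omega> \<longleftrightarrow> f' \<in> L2 \<Omega>"
    by (auto intro!: L2_cong simp: assms)
  ultimately show ?thesis
    by (simp add: has_weak_div_def)
qed

lemma normal_trace_cong:
  assumes "\<And>x. x \<in> \<Omega> \<Longrightarrow> F x = F' x" "\<And>x. x \<in> \<Omega> \<Longrightarrow> f x = f' x"
  shows "normal_trace \<Omega> F f \<phi> h = normal_trace \<Omega> F' f' \<phi> h"
  unfolding normal_trace_def by (rule Bochner_Integration.integral_cong) (auto simp: assms)

text \<open>Integrability comes from the \<open>L2\<close> data carried by the weak divergences and
  by the weak gradient \<open>h\<close>, so \<open>\<phi>\<close> may be any element of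
  \<open>H1 \<Omega>\<close>.\<close>

lemma normal_trace_lincomb:
  assumes F: "has_weak_div \<Omega> F f" and G: "has_weak_div \<Omega> G g" and \<phi>: "has_weak_grad \<Omega> \<phi> h"
  shows "normal_trace \<Omega> (\<lambda>x. c *\<^sub>R F x + d *\<^sub>R G x) (\<lambda>x. c *\<^sub>R f x + d *\<^sub>R g x) \<phi> h
    = c *\<^sub>R normal_trace \<Omega> F f \<phi> h + d *\<^sub>R normal_trace \<Omega> G g \<phi> h"
proof -
  have L2: "F \<in> L2 \<Omega>" "f \<in> L2 \<Omega>" "G \<in> L2 \<Omega>" "g \<in> L2 \<Omega>" "\<phi> \<in> L2 \<Omega>" "h \<in> L2 \<Omega>"
    using assms by (auto simp: has_weak_div_def has_weak_grad_def)
  have "(c *\<^sub>R F x + d *\<^sub>R G x) \<cdot>\<^sub>c h x + (c *\<^sub>R f x + d *\<^sub>R g x) * \<phi> x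
    = c *\<^sub>R (F x \<cdot>\<^sub>c h x + f x * \<phi> x) + d *\<^sub>R (G x \<cdot>\<^sub>c h x + g x * \<phi> x)" for x
    by (simp add: cdot_lincomb distrib_right scaleR_add_right)
  then show ?thesis
    unfolding normal_trace_def
    by (simp add: L2 integrable_mult_L2 integrable_cdot L2_component)
qed

section \<open>The eigenvalue conditions for constant scalar coefficients\<close>

lemma mat_app_mat: "mat_app (mat a) z = a *\<^sub>R z"
proof -
  have "(\<Sum>j\<in>UNIV. complex_of_real (if i = j then a else 0) * z $ j) = a *\<^sub>R z $ i" for i
  proof -
    have "(\<Sum>j\<in>UNIV. complex_of_real (if i = j then a else 0) * z $ j)
        = (\<Sum>j\<in>UNIV. if i = j then a *\<^sub>R z $ j else 0)"
      by (rule sum.cong) (auto simp: scaleR_conv_of_real)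
    then show ?thesis
      by simp
  qed
  then show ?thesis
    by (simp add: mat_app_def mat_def matrix_vector_mult_def vec_eq_iff)
qed

text \<open>Substitutes the constant coefficients and absorbs membership in
  \<open>H1 \<Omega>\<close> into the weak gradients, so that an eigenpair can be unpacked or
  supplied in one existential statement.\<close>

lemma transmission_eigenvalues_scalar:
  assumes "\<forall>x\<in>\<Omega>. A x = mat a" and "\<forall>x\<in>\<Omega>. q x = a"
  shows "k \<in> transmission_eigenvalues \<Omega> A q \<longleftrightarrow> 0 < k \<and>
     (\<exists>u v gu gv. has_weak_grad \<Omega> u gu \<and> has_weak_grad \<Omega> v gv \<and>
        \<not> (zero_on \<Omega> u \<and> zero_on \<Omega> v) \<and>
        has_weak_div \<Omega> (\<lambda>x. a *\<^sub>R gu x) (\<lambda>x. - of_real (k\<^sup>2 * a) * u x) \<and>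
        has_weak_div \<Omega> gv (\<lambda>x. - of_real (k\<^sup>2) * v x) \<and>
        (\<lambda>x. u x - v x) \<in> H1_0 \<Omega> \<and>
        (\<forall>\<phi> h. has_weak_grad \<Omega> \<phi> h \<longrightarrow>
           normal_trace \<Omega> (\<lambda>x. a *\<^sub>R gu x) (\<lambda>x. - of_real (k\<^sup>2 * a) * u x) \<phi> h
           = normal_trace \<Omega> gv (\<lambda>x. - of_real (k\<^sup>2) * v x) \<phi> h))"
proof -
  have "has_weak_div \<Omega> (\<lambda>x. mat_app (A x) (gu x)) (\<lambda>x. - of_real (k\<^sup>2 * q x) * u x) \<longleftrightarrow>
      has_weak_div \<Omega> (\<lambda>x. a *\<^sub>R gu x) (\<lambda>x. - of_real (k\<^sup>2 * a) * u x)" for gu u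
    by (rule has_weak_div_cong) (auto simp: assms mat_app_mat)
  moreover have
    "normal_trace \<Omega> (\<lambda>x. mat_app (A x) (gu x)) (\<lambda>x. - of_real (k\<^sup>2 * q x) * u x) \<phi> h =
      normal_trace \<Omega> (\<lambda>x. a *\<^sub>R gu x) (\<lambda>x. - of_real (k\<^sup>2 * a) * u x) \<phi> h" for gu u \<phi> h
    by (rule normal_trace_cong) (auto simp: assms mat_app_mat)
  ultimately show ?thesis
    by (simp only: transmission_eigenvalues_def eq_on_boundary_def H1_def mem_Collect_eq) blast
qed

text \<open>A weak gradient already witnesses membership in \<open>H1 \<Omega>\<close>, and
  comparing with the zero function in \<open>eq_on_boundary\<close> leaves \<open>w\<close>
  itself.\<close>

lemma dirichlet_eigenvalues_iff:
  "k \<in> dirichlet_eigenvalues \<Omega> \<longleftrightarrow> 0 < k \<and> (\<exists>w g. has_weak_grad \<Omega> w g \<and> \<not> zero_on \<Omega> w \<and>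
     has_weak_div \<Omega> g (\<lambda>x. - of_real (k\<^sup>2) * w x) \<and> w \<in> H1_0 \<Omega>)"
  unfolding dirichlet_eigenvalues_def eq_on_boundary_def H1_def by auto

lemma neumann_eigenvalues_iff:
  "k \<in> neumann_eigenvalues \<Omega> \<longleftrightarrow> 0 < k \<and> (\<exists>w g. has_weak_grad \<Omega> w g \<and> \<not> zero_on \<Omega> w \<and>
     has_weak_div \<Omega> g (\<lambda>x. - of_real (k\<^sup>2) * w x) \<and>
     (\<forall>\<phi> h. has_weak_grad \<Omega> \<phi> h \<longrightarrow> normal_trace \<Omega> g (\<lambda>x. - of_real (k\<^sup>2) * w x) \<phi> h = 0))"
  unfolding neumann_eigenvalues_def H1_def by auto

section \<open>The two inclusions between transmission eigenvalues and Dirichlet or Neumann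
  eigenvalues\<close>

theorem lemma2p1:
  fixes \<Omega> :: "(real ^ 'n) set"
    and A :: "real ^ 'n \<Rightarrow> real ^ 'n ^ 'n"
    and q :: "real ^ 'n \<Rightarrow> real"
    and a :: real
  assumes "CARD('n) \<ge> 2"
    and "open \<Omega>" and "connected \<Omega>" and "\<Omega> \<noteq> {}" and "bounded \<Omega>"
    and "lipschitz_boundary \<Omega>"
    and "connected (- closure \<Omega>)"
    and "0 < a" and "a \<noteq> 1"
    and "\<And>x. x \<in> \<Omega> \<Longrightarrow> A x = mat a"
    and "\<And>x. x \<in> \<Omega> \<Longrightarrow> q x = a"
  shows "transmission_eigenvalues \<Omega> A q = dirichlet_eigenvalues \<Omega> \<union> neumann_eigenvalues \<Omega>"
proof -
  note \<Omega> = \<open>open \<Omega>\<close> \<open>bounded \<Omega>\<close>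
  have "\<forall>x\<in>\<Omega>. A x = mat a" "\<forall>x\<in>\<Omega>. q x = a"
    using assms(10,11) by auto
  note TE_iff = transmission_eigenvalues_scalar[OF this]
  have "k \<in> dirichlet_eigenvalues \<Omega> \<union> neumann_eigenvalues \<Omega>"
    if k: "k \<in> transmission_eigenvalues \<Omega> A q" for k
  proof -
    obtain u v gu gv where "0 < k"
      and gu: "has_weak_grad \<Omega> u gu" and gv: "has_weak_grad \<Omega> v gv"
      and nonzero: "\<not> (zero_on \<Omega> u \<and> zero_on \<Omega> v)"
      and div_u: "has_weak_div \<Omega> (\<lambda>x. a *\<^sub>R gu x) (\<lambda>x. - of_real (k\<^sup>2 * a) * u x)"
      and div_v: "has_weak_div \<Omega> gv (\<lambda>x. - of_real (k\<^sup>2) * v x)"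
      and bdry: "(\<lambda>x. u x - v x) \<in> H1_0 \<Omega>"
      and trace: "\<And>\<phi> h. has_weak_grad \<Omega> \<phi> h \<Longrightarrow>
           normal_trace \<Omega> (\<lambda>x. a *\<^sub>R gu x) (\<lambda>x. - of_real (k\<^sup>2 * a) * u x) \<phi> h
           = normal_trace \<Omega> gv (\<lambda>x. - of_real (k\<^sup>2) * v x) \<phi> h"
      using k unfolding TE_iff by blast
    show ?thesis
    proof (cases "zero_on \<Omega> (\<lambda>x. u x - v x)")
      case False
      have "has_weak_grad \<Omega> (\<lambda>x. u x - v x) (\<lambda>x. gu x - gv x)"
        using has_weak_grad_lincomb[OF \<Omega> gu gv, of 1 "-1"] by simp
      moreover
      \<comment> \<open>The weight \<open>1 / a\<close> turns the flux
        \<open>a *\<^sub>R gu x\<close> back into the gradient of \<open>u\<close> and removes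
        \<open>a\<close> from the source, so the difference solves the Helmholtz equation with the
        same \<open>k\<close>.\<close>
      have "(\<lambda>x. (1 / a) *\<^sub>R (- of_real (k\<^sup>2 * a) * u x) + (-1) *\<^sub>R (- of_real (k\<^sup>2) * v x))
          = (\<lambda>x. - of_real (k\<^sup>2) * (u x - v x))"
        using \<open>0 < a\<close> by (simp add: scaleR_conv_of_real field_simps)
      then have "has_weak_div \<Omega> (\<lambda>x. gu x - gv x) (\<lambda>x. - of_real (k\<^sup>2) * (u x - v x))"
        using has_weak_div_lincomb[OF \<Omega> div_u div_v, of "1 / a" "-1"] \<open>0 < a\<close>
        by (simp only:) simp
      ultimately show ?thesis
        using False bdry \<open>0 < k\<close> unfolding Un_iff dirichlet_eigenvalues_iff by blast
    next
      case True
      let ?w = "\<lambda>x. a *\<^sub>R u x - v x" and ?g = "\<lambda>x. a *\<^sub>R gu x - gv x"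
      \<comment> \<open>The weights are now \<open>1\<close> and \<open>-1\<close>, since the factor
        \<open>a\<close> wanted in \<open>?w\<close> and \<open>?g\<close> already sits in the
        source and the flux of the equation for \<open>u\<close>.\<close>
      have rhs: "(\<lambda>x. 1 *\<^sub>R (- of_real (k\<^sup>2 * a) * u x) + (-1) *\<^sub>R (- of_real (k\<^sup>2) * v x))
          = (\<lambda>x. - of_real (k\<^sup>2) * ?w x)"
        by (simp add: scaleR_conv_of_real algebra_simps)
      have "has_weak_grad \<Omega> ?w ?g"
        using has_weak_grad_lincomb[OF \<Omega> gu gv, of a "-1"] by simp
      moreover have "has_weak_div \<Omega> ?g (\<lambda>x. - of_real (k\<^sup>2) * ?w x)"
        using has_weak_div_lincomb[OF \<Omega> div_u div_v, of 1 "-1"] unfolding rhs by simp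
      moreover have "normal_trace \<Omega> ?g (\<lambda>x. - of_real (k\<^sup>2) * ?w x) \<phi> h = 0"
        if "has_weak_grad \<Omega> \<phi> h" for \<phi> h
        using normal_trace_lincomb[OF div_u div_v that, of 1 "-1"] trace[OF that]
        unfolding rhs by simp
      moreover have "\<not> zero_on \<Omega> ?w"
      proof
        assume "zero_on \<Omega> ?w"
        \<comment> \<open>Almost everywhere both \<open>u = v\<close> and
          \<open>a *\<^sub>R u = v\<close> hold; subtracting them leaves
          \<open>(a - 1) *\<^sub>R u = 0\<close>.\<close>
        then have "AE x in lebesgue_on \<Omega>. u x = 0 \<and> v x = 0"
          using True unfolding zero_on_def
        proof eventually_elim
          case (elim x)
          then have "(a - 1) *\<^sub>R u x = 0"
            by (simp add: algebra_simps)
          with elim \<open>a \<noteq> 1\<close> show ?case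
            by simp
        qed
        with nonzero show False
          by (auto simp: zero_on_def elim: eventually_mono)
      qed
      ultimately show ?thesis
        using \<open>0 < k\<close> unfolding Un_iff neumann_eigenvalues_iff by blast
    qed
  qed
  moreover have "k \<in> transmission_eigenvalues \<Omega> A q"
    if "k \<in> dirichlet_eigenvalues \<Omega> \<union> neumann_eigenvalues \<Omega>" for k
    using that
  proof
    assume "k \<in> dirichlet_eigenvalues \<Omega>"
    then obtain w g where "0 < k" and g: "has_weak_grad \<Omega> w g" and nonzero: "\<not> zero_on \<Omega> w"
      and div: "has_weak_div \<Omega> g (\<lambda>x. - of_real (k\<^sup>2) * w x)" and bdry: "w \<in> H1_0 \<Omega>"
      unfolding dirichlet_eigenvalues_iff by blast
    \<comment> \<open>The solution of \<open>b - a * b = 1\<close>: with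
      \<open>u = b *\<^sub>R w\<close> and \<open>v = a *\<^sub>R u\<close> the difference
      \<open>u - v\<close> is \<open>w\<close>, while \<open>a\<close> times the gradient of
      \<open>u\<close> is the gradient of \<open>v\<close>.\<close>
    define b where "b = 1 / (1 - a)"
    have b: "b \<noteq> 0" "b - a * b = 1"
      using \<open>a \<noteq> 1\<close> by (auto simp: b_def field_simps)
    \<comment> \<open>A second coefficient \<open>0\<close> reduces the linear combination to a
      scalar multiple; the same device recurs below.\<close>
    have grad: "has_weak_grad \<Omega> (\<lambda>x. c *\<^sub>R w x) (\<lambda>x. c *\<^sub>R g x)" for c
      using has_weak_grad_lincomb[OF \<Omega> g g, of c 0] by simp
    have div': "has_weak_div \<Omega> (\<lambda>x. (a * b) *\<^sub>R g x) (\<lambda>x. - of_real (k\<^sup>2) * ((a * b) *\<^sub>R w x))"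
      using has_weak_div_lincomb[OF \<Omega> div div, of "a * b" 0] by simp
    \<comment> \<open>The sources of the two equations coincide as functions, and so do the fluxes.
      The normal traces therefore agree whatever the normal derivative of \<open>w\<close>
      is.\<close>
    have u_rhs: "(\<lambda>x. - of_real (k\<^sup>2 * a) * (b *\<^sub>R w x)) = (\<lambda>x. - of_real (k\<^sup>2) * ((a * b) *\<^sub>R w x))"
      by (simp add: scaleR_conv_of_real mult.assoc)
    have "w x = b *\<^sub>R w x - (a * b) *\<^sub>R w x" for x
      using b(2) by (metis scaleR_left_diff_distrib scaleR_one)
    then have "(\<lambda>x. b *\<^sub>R w x - (a * b) *\<^sub>R w x) \<in> H1_0 \<Omega>"
      using bdry by simp
    moreover have "\<not> zero_on \<Omega> (\<lambda>x. b *\<^sub>R w x)"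
      using nonzero b by (simp add: zero_on_def)
    ultimately show ?thesis
      unfolding TE_iff using \<open>0 < k\<close> grad[of b] grad[of "a * b"] div'
      by (intro conjI exI[of _ "\<lambda>x. b *\<^sub>R w x"] exI[of _ "\<lambda>x. (a * b) *\<^sub>R w x"]
          exI[of _ "\<lambda>x. b *\<^sub>R g x"] exI[of _ "\<lambda>x. (a * b) *\<^sub>R g x"])
        (simp_all only: u_rhs scaleR_scaleR, simp_all)
  next
    assume "k \<in> neumann_eigenvalues \<Omega>"
    then obtain w g where "0 < k" and g: "has_weak_grad \<Omega> w g" and nonzero: "\<not> zero_on \<Omega> w"
      and div: "has_weak_div \<Omega> g (\<lambda>x. - of_real (k\<^sup>2) * w x)"
      and trace: "\<And>\<phi> h. has_weak_grad \<Omega> \<phi> h \<Longrightarrow>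
          normal_trace \<Omega> g (\<lambda>x. - of_real (k\<^sup>2) * w x) \<phi> h = 0"
      unfolding neumann_eigenvalues_iff by blast
    have rhs: "(\<lambda>x. a *\<^sub>R (- of_real (k\<^sup>2) * w x) + 0 *\<^sub>R (- of_real (k\<^sup>2) * w x))
        = (\<lambda>x. - of_real (k\<^sup>2 * a) * w x)"
      by (simp add: scaleR_conv_of_real mult_ac)
    have "has_weak_div \<Omega> (\<lambda>x. a *\<^sub>R g x) (\<lambda>x. - of_real (k\<^sup>2 * a) * w x)"
      using has_weak_div_lincomb[OF \<Omega> div div, of a 0] unfolding rhs by simp
    \<comment> \<open>Both sides vanish: the left one is \<open>a\<close> times the normal trace of
      \<open>w\<close>, which is zero by the Neumann condition.\<close>
    moreover have "normal_trace \<Omega> (\<lambda>x. a *\<^sub>R g x) (\<lambda>x. - of_real (k\<^sup>2 * a) * w x) \<phi> h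
        = normal_trace \<Omega> g (\<lambda>x. - of_real (k\<^sup>2) * w x) \<phi> h"
      if "has_weak_grad \<Omega> \<phi> h" for \<phi> h
      using normal_trace_lincomb[OF div div that, of a 0] trace[OF that] unfolding rhs by simp
    moreover have "(\<lambda>x. w x - w x) \<in> H1_0 \<Omega>"
      by (simp add: zero_H1_0)
    ultimately show ?thesis
      unfolding TE_iff using \<open>0 < k\<close> g nonzero div by blast
  qed
  ultimately show ?thesis
    by blast
qed

end
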